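(* Let $e,d\ge1$ be integers, and for $D\in\mathbb{R}^{e\times d}$ write $D_c=\Pi_\perp D$. Let $\Psi\colon\mathbb{S}^e_+\to\mathbb{R}^{e\times e}$ be permutation equivariant and map the centered expert subspace to itself. Then the centered left-spectral update $$\mathscr{U}^{\mathrm{router}}_{\mathsf L}(D)=\Psi(D_cD_c^\top)\,D_c$$ is router-compatible. Moreover, for any function $\eta\colon[0,\infty)\to\mathbb{R}$, the projected centered row-norm update $$\mathscr{U}^{\mathrm{router}}_{\mathrm{row}}(D)=\Pi_\perp\,\mathrm{Diag}\bigl(\eta(\|D_{c,1:}\|_2),\dots,\eta(\|D_{c,e:}\|_2)\bigr)\,D_c$$ is router-compatible. In particular, for all $D\in\mathbb{R}^{e\times d}$, all $e\times e$ permutation matrices $P$ and all $a\in\mathbb{R}^d$, $$\mathscr{U}^{\mathrm{router}}_{\mathsf L}(PD+\mathbf 1_ea^\top)=P\,\mathscr{U}^{\mathrm{router}}_{\mathsf L}(D),\qquad \mathscr{U}^{\mathrm{router}}_{\mathrm{row}}(PD+\mathbf 1_ea^\top)=P\,\mathscr{U}^{\mathrm{router}}_{\mathrm{row}}(D),$$ and both updates satisfy $$\mathbf 1_e^\top\mathscr{U}^{\mathrm{router}}_{\mathsf L}(D)=0,\qquad \mathbf 1_e^\top\mathscr{U}^{\mathrm{router}}_{\mathrm{row}}(D)=0.$$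
   Context: $\mathbf 1_e\in\mathbb{R}^e$ is the all-ones vector and $\Pi_\perp=I_e-\frac1e\mathbf 1_e\mathbf 1_e^\top$ is the orthogonal projector onto the centered expert subspace $\mathbf 1_e^\perp$. $D_{c,i:}$ is the $i$-th row of $D_c$. $\mathbb{S}^e_+$ is the set of symmetric positive semidefinite $e\times e$ matrices. A map $\mathscr{U}\colon\mathbb{R}^{e\times d}\to\mathbb{R}^{e\times d}$ is router-compatible if $\mathscr{U}(PD+\mathbf 1_ea^\top)=P\,\mathscr{U}(D)$ and $\mathbf 1_e^\top\mathscr{U}(D)=0$ for all $D\in\mathbb{R}^{e\times d}$, all $e\times e$ permutation matrices $P$, and all $a\in\mathbb{R}^d$. $\Psi$ is permutation equivariant if $\Psi(PXP^\top)=P\Psi(X)P^\top$ for all $X\in\mathbb{S}^e_+$ and all permutation matrices $P$. $\Psi$ maps the centered expert subspace to itself if, for every $D\in\mathbb{R}^{e\times d}$, the matrix $\Psi(D_cD_c^\top)$ maps $\mathbf 1_e^\perp$ into $\mathbf 1_e^\perp$. *)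

theory Defs
  imports "HOL-Analysis.Analysis"
begin

text \<open>
  Matrices in \<open>\<real>\<^sup>e\<^sup>\<times>\<^sup>d\<close> have type \<^typ>\<open>real^'d^'e\<close>; the row index \<open>'e\<close> ranges over the experts.
  The all-ones vector is \<^term>\<open>1 :: real^'e\<close>, the unit of the componentwise product.
\<close>

text \<open>The rank-one matrix \<open>u v\<^sup>T\<close>.\<close>

definition outer :: "real^'m \<Rightarrow> real^'n \<Rightarrow> real^'n^'m" where
  "outer u v = (columnvector u :: real^1^'m) ** (rowvector v :: real^'n^1)"

lemma outer_nth [simp]: "outer u v $ i $ j = u $ i * v $ j"
  by (simp add: outer_def matrix_matrix_mult_def columnvector_def rowvector_def)

definition diag_matrix :: "real^'n \<Rightarrow> real^'n^'n" where
  "diag_matrix v = (\<chi> i j. if i = j then v $ i else 0)"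

definition permutation_matrix :: "real^'n^'n \<Rightarrow> bool" where
  "permutation_matrix P \<longleftrightarrow>
    (\<exists>p. p permutes (UNIV :: 'n set) \<and> P = (\<chi> i j. if i = p j then 1 else 0))"

definition sym_psd :: "(real^'n^'n) set" where
  "sym_psd = {X. transpose X = X \<and> (\<forall>x. 0 \<le> x \<bullet> (X *v x))}"

definition centered_subspace :: "(real^'e) set" where
  "centered_subspace = orthogonal_comp {1}"

definition centering_projector :: "real^'e^'e" where
  "centering_projector = mat 1 - (1 / real CARD('e)) *\<^sub>R outer 1 1"

definition centered :: "real^'d^'e \<Rightarrow> real^'d^'e" where
  "centered D = centering_projector ** D"

definition router_compatible :: "(real^'d^'e \<Rightarrow> real^'d^'e) \<Rightarrow> bool" where
  "router_compatible U \<longleftrightarrow>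
    (\<forall>D P a. permutation_matrix P \<longrightarrow> U (P ** D + outer 1 a) = P ** U D) \<and>
    (\<forall>D. 1 v* U D = 0)"

text \<open>
  A map defined on \<^const>\<open>sym_psd\<close> is represented by a total function whose values elsewhere are
  unconstrained.
\<close>

definition permutation_equivariant :: "(real^'e^'e \<Rightarrow> real^'e^'e) \<Rightarrow> bool" where
  "permutation_equivariant \<Psi> \<longleftrightarrow>
    (\<forall>X\<in>sym_psd. \<forall>P. permutation_matrix P \<longrightarrow>
       \<Psi> (P ** X ** transpose P) = P ** \<Psi> X ** transpose P)"

text \<open>
  The condition ranges over all \<open>D\<close> with \<open>d\<close> columns, so it depends on the index type \<open>'d\<close>, which
  does not occur in the type of \<open>\<Psi>\<close>.
\<close>

definition preserves_centered ::
    "'d::finite itself \<Rightarrow> (real^'e^'e \<Rightarrow> real^'e^'e) \<Rightarrow> bool" where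
  "preserves_centered _ \<Psi> \<longleftrightarrow>
    (\<forall>D :: real^'d^'e. \<forall>x\<in>centered_subspace.
       \<Psi> (centered D ** transpose (centered D)) *v x \<in> centered_subspace)"

definition left_spectral_update ::
    "(real^'e^'e \<Rightarrow> real^'e^'e) \<Rightarrow> real^'d^'e \<Rightarrow> real^'d^'e" where
  "left_spectral_update \<Psi> D = \<Psi> (centered D ** transpose (centered D)) ** centered D"

text \<open>Only the values of \<open>\<eta>\<close> on \<open>[0, \<infinity>)\<close> enter.\<close>

definition row_norm_update :: "(real \<Rightarrow> real) \<Rightarrow> real^'d^'e \<Rightarrow> real^'d^'e" where
  "row_norm_update \<eta> D =
    centering_projector ** diag_matrix (\<chi> i. \<eta> (norm (row i (centered D)))) ** centered D"

end

theory Submission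
  imports Defs
begin

text \<open>
  Both updates are built from \<open>centered D\<close>, which a permutation \<open>P\<close> turns into \<open>P ** centered D\<close>
  and which a common shift of the rows does not change. Equivariance then reduces to \<open>P\<^sup>T P = I\<close> and to
  \<open>P\<close> commuting with the projector; the row-norm diagonal matrix is conjugated by \<open>P\<close> because \<open>P\<close>
  permutes the rows.
\<close>

lemma matrix_mul_outer: "A ** outer u v = outer (A *v u) v"
  by (simp add: vec_eq_iff matrix_matrix_mult_def matrix_vector_mult_def sum_distrib_right mult.assoc)

lemma outer_mul_matrix: "outer u v ** A = outer u (v v* A)"
  by (simp add: vec_eq_iff matrix_matrix_mult_def vector_matrix_mult_def sum_distrib_left mult.assoc
      mult.commute mult.left_commute)

lemma matrix_sub_ldistrib: "A ** (B - C) = A ** B - A ** C" for A :: "'a::ring_1^'n^'m"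
  by (simp add: vec_eq_iff matrix_matrix_mult_def right_diff_distrib sum_subtractf)

lemma matrix_sub_rdistrib: "(A - B) ** C = A ** C - B ** C" for A :: "'a::ring_1^'n^'m"
  by (simp add: vec_eq_iff matrix_matrix_mult_def left_diff_distrib sum_subtractf)

text \<open>The definition locates the one in each column. Passing to the inverse permutation
  locates it in each row, so that left multiplication by \<open>P\<close> replaces row
  \<open>i\<close> by row \<open>q i\<close>.\<close>

lemma permutation_matrixE:
  fixes P :: "real^'n^'n"
  assumes "permutation_matrix P"
  obtains q where "q permutes UNIV" "P = (\<chi> i j. if q i = j then 1 else 0)"
proof -
  obtain p where p: "p permutes (UNIV :: 'n set)" "P = (\<chi> i j. if i = p j then 1 else 0)"
    using assms unfolding permutation_matrix_def by blast
  show thesis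
  proof (rule that)
    show "inv p permutes UNIV" using p(1) by (rule permutes_inv)
    show "P = (\<chi> i j. if inv p i = j then 1 else 0)"
      using p by (auto simp: vec_eq_iff permutes_inv_eq)
  qed
qed

lemma permutation_matrix_mul_nth:
  "(\<chi> i j. if q i = j then 1 else 0) ** (A :: real^'m^'n) = (\<chi> i. A $ q i)"
  by (simp add: vec_eq_iff matrix_matrix_mult_def if_distrib[where f = "\<lambda>x. x * _"] cong: if_cong)

lemma permutation_matrix_transpose_mul:
  fixes P :: "real^'n^'n"
  assumes "permutation_matrix P"
  shows "transpose P ** P = mat 1"
proof -
  obtain q where q: "q permutes UNIV" and P: "P = (\<chi> i j. if q i = j then 1 else 0)"
    using assms by (rule permutation_matrixE)
  \<comment> \<open>Entry \<open>(i, j)\<close> is one exactly when \<open>q i = q j\<close>, so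
    this is injectivity of \<open>q\<close>. For square matrices a right inverse is also a left
    inverse, which gives the other order.\<close>
  have "P ** transpose P = mat 1"
    unfolding P permutation_matrix_mul_nth
    using permutes_inj[OF q] by (auto simp: vec_eq_iff transpose_def mat_def inj_eq)
  then show ?thesis by (simp add: matrix_left_right_inverse)
qed

lemma permutation_matrix_mul_one:
  fixes P :: "real^'n^'n"
  assumes "permutation_matrix P"
  shows "P *v 1 = 1"
  using assms by (elim permutation_matrixE) (simp add: vec_eq_iff matrix_vector_mult_def)

lemma one_mul_permutation_matrix:
  fixes P :: "real^'n^'n"
  assumes "permutation_matrix P"
  shows "1 v* P = 1"
  using assms by (auto simp: permutation_matrix_def vec_eq_iff vector_matrix_mult_def)

text \<open>Row \<open>i\<close> of \<open>P ** A\<close> is row \<open>q i\<close> of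
  \<open>A\<close>, so on both sides the only possibly nonzero entry of row \<open>i\<close> is
  \<open>f (row (q i) A)\<close> in column \<open>q i\<close>. This is conjugation of the diagonal
  matrix by \<open>P\<close>, in a form that lets \<open>P\<close> move to the left.\<close>

lemma permutation_matrix_mul_diag:
  fixes P :: "real^'n^'n" and A :: "real^'m^'n"
  assumes "permutation_matrix P"
  shows "diag_matrix (\<chi> i. f (row i (P ** A))) ** P = P ** diag_matrix (\<chi> i. f (row i A))"
proof -
  obtain q where "q permutes UNIV" and P: "P = (\<chi> i j. if q i = j then 1 else 0)"
    using assms by (rule permutation_matrixE)
  show ?thesis
    unfolding P permutation_matrix_mul_nth
    by (auto simp: vec_eq_iff diag_matrix_def matrix_matrix_mult_def row_def
        if_distrib[where f = "\<lambda>x. x * _"] cong: if_cong)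
qed

text \<open>\<open>outer 1 1\<close> multiplies \<open>1\<close> by the number of experts, which the
  factor in the projector cancels.\<close>

lemma centering_projector_mul_one: "centering_projector *v 1 = 0"
  by (simp add: centering_projector_def matrix_vector_mult_diff_rdistrib
      flip: scaleR_matrix_vector_assoc) (simp add: vec_eq_iff matrix_vector_mult_def)

lemma one_mul_centering_projector: "1 v* (centering_projector :: real^'n^'n) = 0"
proof -
  have "transpose (centering_projector :: real^'n^'n) = centering_projector"
    by (auto simp: centering_projector_def vec_eq_iff transpose_def mat_def)
  then show ?thesis
    using centering_projector_mul_one by (metis transpose_matrix_vector)
qed

text \<open>All row and column sums of \<open>P\<close> are one, so multiplying
  \<open>outer 1 1\<close> by \<open>P\<close> on either side leaves it unchanged.\<close>

lemma centering_projector_permutation_matrix: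
  fixes P :: "real^'n^'n"
  assumes "permutation_matrix P"
  shows "centering_projector ** P = P ** centering_projector"
proof -
  have "outer 1 1 ** P = P ** outer 1 1"
    using assms by (simp add: outer_mul_matrix matrix_mul_outer one_mul_permutation_matrix
        permutation_matrix_mul_one)
  then show ?thesis
    by (simp add: centering_projector_def matrix_sub_ldistrib matrix_sub_rdistrib
        matrix_scalar_ac flip: scalar_matrix_assoc)
qed

lemma centered_permutation_shift:
  assumes "permutation_matrix P"
  shows "centered (P ** D + outer 1 a) = P ** centered D"
proof -
  have "centering_projector ** outer 1 a = 0"
    by (simp add: matrix_mul_outer centering_projector_mul_one) (simp add: vec_eq_iff)
  then show ?thesis
    using centering_projector_permutation_matrix[OF assms]
    by (simp add: centered_def matrix_add_ldistrib matrix_mul_assoc)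
qed

text \<open>Makes \<open>preserves_centered\<close>, a condition on vectors, applicable to the
  matrix \<open>centered D\<close> column by column.\<close>

lemma column_centered_mem: "column j (centered D) \<in> centered_subspace"
proof -
  have "1 v* centered D = 0"
    by (simp add: centered_def one_mul_centering_projector flip: vector_matrix_mul_assoc)
  then show ?thesis
    by (simp add: centered_subspace_def orthogonal_comp_def orthogonal_def inner_vec_def column_def
        vec_eq_iff vector_matrix_mult_def)
qed

text \<open>Equivariance of \<open>\<Psi>\<close> is assumed on \<open>sym_psd\<close> only. The
  quadratic form of a Gram matrix is the squared norm of \<open>transpose A *v x\<close>.\<close>

lemma gram_mem_sym_psd: "A ** transpose A \<in> sym_psd"
proof -
  have "x \<bullet> ((A ** transpose A) *v x) = (transpose A *v x) \<bullet> (transpose A *v x)" for x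
    by (simp add: dot_lmul_matrix flip: matrix_vector_mul_assoc)
  then show ?thesis by (simp add: sym_psd_def matrix_transpose_mul)
qed

lemma router_compatible_left_spectral_update:
  fixes \<Psi> :: "real^'e^'e \<Rightarrow> real^'e^'e"
  assumes equiv: "permutation_equivariant \<Psi>"
    and pres: "preserves_centered TYPE('d::finite) \<Psi>"
  shows "router_compatible (left_spectral_update \<Psi> :: real^'d^'e \<Rightarrow> real^'d^'e)"
  unfolding router_compatible_def
proof (intro conjI allI impI)
  fix D :: "real^'d^'e" and P :: "real^'e^'e" and a
  assume P: "permutation_matrix P"
  let ?C = "centered D"
  have "left_spectral_update \<Psi> (P ** D + outer 1 a)
      = \<Psi> (P ** (?C ** transpose ?C) ** transpose P) ** (P ** ?C)"
    by (simp add: left_spectral_update_def centered_permutation_shift[OF P] matrix_transpose_mul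
        matrix_mul_assoc)
  also have "\<dots> = P ** \<Psi> (?C ** transpose ?C) ** transpose P ** (P ** ?C)"
    using equiv P gram_mem_sym_psd unfolding permutation_equivariant_def by metis
  also have "\<dots> = P ** \<Psi> (?C ** transpose ?C) ** (transpose P ** P) ** ?C"
    by (simp only: matrix_mul_assoc)
  also have "\<dots> = P ** left_spectral_update \<Psi> D"
    by (simp add: permutation_matrix_transpose_mul[OF P] left_spectral_update_def matrix_mul_assoc)
  finally show "left_spectral_update \<Psi> (P ** D + outer 1 a) = P ** left_spectral_update \<Psi> D" .
next
  fix D :: "real^'d^'e"
  let ?M = "\<Psi> (centered D ** transpose (centered D))"
  \<comment> \<open>Column \<open>j\<close> of the update is \<open>?M\<close> applied to column
    \<open>j\<close> of \<open>centered D\<close>, and component \<open>j\<close> here is its inner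
    product with \<open>1\<close>.\<close>
  have "(1 v* left_spectral_update \<Psi> D) $ j = 0" for j
  proof -
    have "?M *v column j (centered D) \<in> centered_subspace"
      using pres column_centered_mem unfolding preserves_centered_def by blast
    then have "1 \<bullet> (?M *v column j (centered D)) = 0"
      by (simp add: centered_subspace_def orthogonal_comp_def orthogonal_def)
    then show ?thesis
      by (simp add: left_spectral_update_def inner_vec_def vector_matrix_mult_def column_def
          matrix_vector_mult_def matrix_matrix_mult_def)
  qed
  then show "1 v* left_spectral_update \<Psi> D = 0" by (simp add: vec_eq_iff)
qed

lemma router_compatible_row_norm_update: "router_compatible (row_norm_update \<eta>)"
  unfolding router_compatible_def
proof (intro conjI allI impI)
  fix D :: "real^'d^'e" and P :: "real^'e^'e" and a
  assume P: "permutation_matrix P"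
  let ?C = "centered D"
  \<comment> \<open>The product is bracketed so that the \<open>P\<close> from
    \<open>P ** ?C\<close> stands next to the diagonal matrix; it then passes first that matrix and
    then the projector.\<close>
  have "row_norm_update \<eta> (P ** D + outer 1 a)
      = centering_projector ** (diag_matrix (\<chi> i. \<eta> (norm (row i (P ** ?C)))) ** P) ** ?C"
    by (simp add: row_norm_update_def centered_permutation_shift[OF P] matrix_mul_assoc)
  also have "\<dots> = (centering_projector ** P) ** diag_matrix (\<chi> i. \<eta> (norm (row i ?C))) ** ?C"
    by (simp add: permutation_matrix_mul_diag[OF P, where f = "\<lambda>r. \<eta> (norm r)"] matrix_mul_assoc)
  also have "\<dots> = P ** row_norm_update \<eta> D"
    by (simp add: centering_projector_permutation_matrix[OF P] row_norm_update_def matrix_mul_assoc)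
  finally show "row_norm_update \<eta> (P ** D + outer 1 a) = P ** row_norm_update \<eta> D" .
next
  fix D :: "real^'d^'e"
  \<comment> \<open>Row scaling can destroy centering; the leftmost projector restores it, since
    \<open>1\<close> annihilates it from the left.\<close>
  show "1 v* row_norm_update \<eta> D = 0"
    by (simp add: row_norm_update_def one_mul_centering_projector flip: vector_matrix_mul_assoc)
qed

theorem proposition3p5:
  fixes \<Psi> :: "real^'e^'e \<Rightarrow> real^'e^'e" and \<eta> :: "real \<Rightarrow> real"
  assumes "permutation_equivariant \<Psi>"
    and "preserves_centered TYPE('d::finite) \<Psi>"
  shows "router_compatible (left_spectral_update \<Psi> :: real^'d^'e \<Rightarrow> real^'d^'e)
    \<and> router_compatible (row_norm_update \<eta> :: real^'d^'e \<Rightarrow> real^'d^'e)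
    \<and> (\<forall>(D :: real^'d^'e) P a. permutation_matrix P \<longrightarrow>
         left_spectral_update \<Psi> (P ** D + outer 1 a) = P ** left_spectral_update \<Psi> D
       \<and> row_norm_update \<eta> (P ** D + outer 1 a) = P ** row_norm_update \<eta> D)
    \<and> (\<forall>D :: real^'d^'e.
         1 v* left_spectral_update \<Psi> D = 0 \<and> 1 v* row_norm_update \<eta> D = 0)"
  using router_compatible_left_spectral_update[OF assms]
    router_compatible_row_norm_update[of \<eta>, where ?'a = 'd and ?'b = 'e]
  unfolding router_compatible_def by blast

end
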